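(* For every $\gamma\in[0,1]$, $$P\preceq_{s,\lambda,\gamma}^{\rm CSD}Q\quad\Longleftrightarrow\quad \Delta_s(P,Q)\ge\frac{1-\gamma}{1+\gamma}\,W_s(P,Q).$$
   Context: Let $D\subseteq\mathbb R^d$ be a nonempty Borel set; $P,Q$ are Borel probability measures supported on $D$ (i.e. $P(D)=Q(D)=1$) with finite first moments. $\mathcal C(P,Q)$ is the set of couplings of $P$ and $Q$ (first marginal $P$, second marginal $Q$), and $t_+:=\max\{t,0\}$. Let $(\Theta,\mathscr A,\lambda)$ be a finite measure space and $s:\Theta\times\mathbb R^d\to\mathbb R$ jointly measurable; write $s_\theta(x):=s(\theta,x)$. Standing assumptions: each $s_\theta$ is coordinatewise nondecreasing, $\int_\Theta|s_\theta(0)|\,\lambda(d\theta)<\infty$, and for some finite constant $\overline L_s$, $\int_\Theta|s_\theta(x)-s_\theta(y)|\,\lambda(d\theta)\le\overline L_s\|x-y\|_1$ for all $x,y\in\mathbb R^d$. Define $S(x):=\int_\Theta s_\theta(x)\,\lambda(d\theta)$, $d_s(x,y):=\int_\Theta|s_\theta(x)-s_\theta(y)|\,\lambda(d\theta)$, $W_s(P,Q):=\inf_{\kappa\in\mathcal C(P,Q)}\int_{D\times D}d_s\,d\kappa$, and $\Delta_s(P,Q):=\int_D S\,dQ-\int_D S\,dP$. Compensated stochastic dominance (CSD): for $\gamma\in[0,1]$, $P\preceq_{s,\lambda,\gamma}^{\rm CSD}Q$ means that there exists $\kappa\in\mathcal C(P,Q)$ with $$\int_{D\times D}\int_\Theta(s_\theta(x)-s_\theta(y))_+\,\lambda(d\theta)\,\kappa(dx,dy)\le\gamma\int_{D\times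 D}\int_\Theta(s_\theta(y)-s_\theta(x))_+\,\lambda(d\theta)\,\kappa(dx,dy).$$ *)

theory Defs
  imports "HOL-Probability.Probability"
begin

definition l1_norm :: "real ^ 'n \<Rightarrow> real" where
  "l1_norm x = (\<Sum>i\<in>UNIV. \<bar>x $ i\<bar>)"

definition couplings ::
  "(real ^ 'n) measure \<Rightarrow> (real ^ 'n) measure \<Rightarrow> ((real ^ 'n) \<times> (real ^ 'n)) measure set" where
  "couplings P Q =
     {\<kappa>. sets \<kappa> = sets (borel \<Otimes>\<^sub>M borel) \<and> distr \<kappa> borel fst = P \<and> distr \<kappa> borel snd = Q}"

definition S_int :: "'t measure \<Rightarrow> ('t \<Rightarrow> real ^ 'n \<Rightarrow> real) \<Rightarrow> real ^ 'n \<Rightarrow> real" where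
  "S_int M s x = (LINT \<theta>|M. s \<theta> x)"

definition d_cost :: "'t measure \<Rightarrow> ('t \<Rightarrow> real ^ 'n \<Rightarrow> real) \<Rightarrow> real ^ 'n \<Rightarrow> real ^ 'n \<Rightarrow> real" where
  "d_cost M s x y = (LINT \<theta>|M. \<bar>s \<theta> x - s \<theta> y\<bar>)"

text \<open>The infimum below is taken in the reals. Under the assumptions on \<open>P\<close>, \<open>Q\<close> and \<open>s\<close>
  used with it, the set of costs is nonempty (product coupling), bounded below by 0, and all
  integrals are finite.\<close>

definition W_dist ::
  "(real ^ 'n) set \<Rightarrow> 't measure \<Rightarrow> ('t \<Rightarrow> real ^ 'n \<Rightarrow> real)
     \<Rightarrow> (real ^ 'n) measure \<Rightarrow> (real ^ 'n) measure \<Rightarrow> real" where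
  "W_dist D M s P Q = (INF \<kappa>\<in>couplings P Q. (LINT z:D \<times> D|\<kappa>. d_cost M s (fst z) (snd z)))"

definition Delta ::
  "(real ^ 'n) set \<Rightarrow> 't measure \<Rightarrow> ('t \<Rightarrow> real ^ 'n \<Rightarrow> real)
     \<Rightarrow> (real ^ 'n) measure \<Rightarrow> (real ^ 'n) measure \<Rightarrow> real" where
  "Delta D M s P Q = (LINT x:D|Q. S_int M s x) - (LINT x:D|P. S_int M s x)"

definition CSD ::
  "(real ^ 'n) set \<Rightarrow> 't measure \<Rightarrow> ('t \<Rightarrow> real ^ 'n \<Rightarrow> real) \<Rightarrow> real
     \<Rightarrow> (real ^ 'n) measure \<Rightarrow> (real ^ 'n) measure \<Rightarrow> bool" where
  "CSD D M s \<gamma> P Q \<longleftrightarrow>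
     (\<exists>\<kappa>\<in>couplings P Q.
        (LINT z:D \<times> D|\<kappa>. (LINT \<theta>|M. max (s \<theta> (fst z) - s \<theta> (snd z)) 0))
        \<le> \<gamma> * (LINT z:D \<times> D|\<kappa>. (LINT \<theta>|M. max (s \<theta> (snd z) - s \<theta> (fst z)) 0)))"

end

theory Submission
  imports Defs
begin

text \<open>
  For a coupling, let \<open>a\<close> and \<open>b\<close> be the left and right integrals in the definition of CSD. Then
  \<open>a + b\<close> is the transport cost and \<open>b - a = Delta\<close> does not depend on the coupling, so
  \<open>a \<le> \<gamma> * b\<close> says that the cost is at most \<open>(1 + \<gamma>) / (1 - \<gamma>) * Delta\<close> (for \<open>\<gamma> < 1\<close>). The theorem
  therefore amounts to the existence of an optimal coupling.

  Compactness of the couplings is reduced to Helly's selection theorem on the real line.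
  Schoenberg's space-filling curve, composed with a homeomorphism from the open cube onto the
  Euclidean space, maps an open set of reals continuously onto that space; its smallest-preimage section is Borel,
  so that a tight sequence of measures can be moved to \<open>{0..1}\<close>, passed to a limit there and moved back.
\<close>

section \<open>Binary digits, Cantor points and Schoenberg's curve\<close>

text \<open>Greedy algorithm: double the remainder and subtract 1 whenever it was at least 1/2. The
  remainder \<open>r n\<close> never leaves \<open>{0..1}\<close>, so the error
  \<open>r n / 2 ^ n\<close> of the partial sums tends to 0. For \<open>a = 1\<close> all digits are
  1.\<close>

lemma binary_expansion:
  fixes a :: real
  assumes "a \<in> {0..1}"
  obtains b :: "nat \<Rightarrow> real" where "\<And>k. b k \<in> {0, 1}" "(\<lambda>k. b k / 2 ^ Suc k) sums a"
proof
  define r where "r = rec_nat a (\<lambda>_ x. 2 * x - (if 1 / 2 \<le> x then 1 else 0))"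
  have r_0: "r 0 = a" and r_Suc: "r (Suc k) = 2 * r k - (if 1 / 2 \<le> r k then 1 else 0)" for k
    by (simp_all add: r_def)
  define b :: "nat \<Rightarrow> real" where "b k = (if 1 / 2 \<le> r k then 1 else 0)" for k
  have r_range: "r k \<in> {0..1}" for k
    by (induction k) (use assms in \<open>auto simp: r_0 r_Suc\<close>)
  have "(\<Sum>k<n. b k / 2 ^ Suc k) = a - r n / 2 ^ n" for n
    by (induction n) (auto simp: r_0 r_Suc b_def field_simps)
  moreover have "(\<lambda>n. r n / 2 ^ n) \<longlonglongrightarrow> 0"
  proof (rule tendsto_sandwich)
    show "\<forall>\<^sub>F n in sequentially. r n / 2 ^ n \<le> (1 / 2) ^ n"
      using r_range by (auto simp: power_divide divide_right_mono)
    show "\<forall>\<^sub>F n in sequentially. 0 \<le> r n / 2 ^ n"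
      using r_range by auto
  qed (auto intro: LIMSEQ_realpow_zero)
  ultimately show "(\<lambda>k. b k / 2 ^ Suc k) sums a"
    unfolding sums_def using tendsto_diff[OF tendsto_const[of a]] by fastforce
  show "b k \<in> {0, 1}" for k
    by (simp add: b_def)
qed

text \<open>Schoenberg's auxiliary function, with a clipped cosine in place of a piecewise linear
  graph. It is continuous with period 2, equals 0 on \<open>{0..1/3}\<close> and 1 on
  \<open>{2/3..1}\<close>, because the cosine of \<open>pi / 3\<close> is 1/2 and that of
  \<open>2 * pi / 3\<close> is -1/2.\<close>

definition wave :: "real \<Rightarrow> real" where
  "wave t = max 0 (min 1 (1 / 2 - cos (pi * t)))"

lemma continuous_on_wave [continuous_intros]:
  fixes f :: "'a::t2_space \<Rightarrow> real"
  shows "continuous_on A f \<Longrightarrow> continuous_on A (\<lambda>x. wave (f x))"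
  unfolding wave_def by (intro continuous_intros)

lemma wave_bounds: "0 \<le> wave t" "wave t \<le> 1"
  by (auto simp: wave_def)

lemma wave_add_even: "wave (2 * real N + t) = wave t"
proof -
  have "cos (pi * (2 * real N + t)) = cos (pi * t + 2 * real N * pi)"
    by (simp add: algebra_simps)
  also have "\<dots> = cos (pi * t)"
    unfolding cos_add by simp
  finally show ?thesis
    by (simp add: wave_def)
qed

text \<open>The point of the Cantor set with ternary digits \<open>2 * b k\<close>. As the digit 1
  never occurs, the open middle third, where \<open>wave\<close> climbs from 0 to 1, is avoided at
  every scale.\<close>

definition cantor_sum :: "(nat \<Rightarrow> real) \<Rightarrow> real" where
  "cantor_sum b = (\<Sum>k. 2 * b k / 3 ^ Suc k)"

context
  fixes b :: "nat \<Rightarrow> real"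
  assumes digits: "\<And>k. b k \<in> {0, 1}"
begin

text \<open>Stated for all tails of the digit sequence, since digits are stripped off one at a time
  below.\<close>

lemma cantor_summable: "summable (\<lambda>k. 2 * b (k + n) / 3 ^ Suc k)"
proof (rule summable_comparison_test')
  show "summable (\<lambda>k. 2 / 3 * (1 / 3 :: real) ^ k)"
    by (intro summable_mult summable_geometric) simp
  show "norm (2 * b (k + n) / 3 ^ Suc k) \<le> 2 / 3 * (1 / 3) ^ k" for k
    using digits[of "k + n"] by (auto simp: power_divide)
qed

text \<open>The extreme case has all ternary digits equal to 2, a geometric series with sum
  1.\<close>

lemma cantor_sum_bounds: "cantor_sum (\<lambda>k. b (k + n)) \<in> {0..1}"
proof -
  have g: "(\<lambda>k. 2 / 3 * (1 / 3 :: real) ^ k) sums (2 / 3 * (1 / (1 - 1 / 3)))"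
    by (intro sums_mult geometric_sums) simp
  have "cantor_sum (\<lambda>k. b (k + n)) \<le> (\<Sum>k. 2 / 3 * (1 / 3) ^ k)"
    unfolding cantor_sum_def
  proof (rule suminf_le[OF _ cantor_summable sums_summable[OF g]])
    show "2 * b (k + n) / 3 ^ Suc k \<le> 2 / 3 * (1 / 3) ^ k" for k
      using digits[of "k + n"] by (auto simp: power_divide)
  qed
  moreover have "0 \<le> cantor_sum (\<lambda>k. b (k + n))"
    unfolding cantor_sum_def
  proof (rule suminf_nonneg[OF cantor_summable])
    show "0 \<le> 2 * b (k + n) / 3 ^ Suc k" for k
      using digits[of "k + n"] by auto
  qed
  ultimately show ?thesis
    using sums_unique[OF g] by simp
qed

lemma cantor_sum_shift:
  "3 * cantor_sum (\<lambda>k. b (k + n)) = 2 * b n + cantor_sum (\<lambda>k. b (k + Suc n))"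
proof -
  have "cantor_sum (\<lambda>k. b (k + n)) = (\<Sum>k. 2 * b (Suc k + n) / 3 ^ Suc (Suc k)) + 2 * b n / 3"
    unfolding cantor_sum_def using suminf_split_head[OF cantor_summable[of n]] by simp
  also have "(\<Sum>k. 2 * b (Suc k + n) / 3 ^ Suc (Suc k)) = (\<Sum>k. 2 * b (k + Suc n) / 3 ^ Suc k / 3)"
    by simp
  also have "\<dots> = cantor_sum (\<lambda>k. b (k + Suc n)) / 3"
    unfolding cantor_sum_def by (rule suminf_divide[OF cantor_summable])
  finally show ?thesis
    by simp
qed

text \<open>Multiplication by \<open>3 ^ n\<close> moves the first \<open>n\<close> ternary digits
  into the integer part. That part is even because the digits are 0 or 2, so periodicity removes it.
  The remaining tail lies in the first third if \<open>b n = 0\<close> and in the last third if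
  \<open>b n = 1\<close>, where \<open>wave\<close> is constant.\<close>

lemma wave_cantor_sum: "wave (3 ^ n * cantor_sum b) = b n"
proof -
  have "\<exists>N. 3 ^ n * cantor_sum b = 2 * real N + cantor_sum (\<lambda>k. b (k + n))"
  proof (induction n)
    case (Suc n)
    then obtain N where N: "3 ^ n * cantor_sum b = 2 * real N + cantor_sum (\<lambda>k. b (k + n))"
      by blast
    have "3 ^ Suc n * cantor_sum b = 3 * (3 ^ n * cantor_sum b)"
      by simp
    also have "\<dots> = 2 * (3 * real N + b n) + cantor_sum (\<lambda>k. b (k + Suc n))"
      unfolding N distrib_left cantor_sum_shift by simp
    \<comment> \<open>Digits are real numbers here; the conditional turns the digit into a natural
      number, as the next witness must be one.\<close>
    also have "3 * real N + b n = real (3 * N + (if b n = 0 then 0 else 1))"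
      using digits[of n] by auto
    finally show ?case
      by blast
  qed (auto intro: exI[of _ 0])
  then have "wave (3 ^ n * cantor_sum b) = wave (cantor_sum (\<lambda>k. b (k + n)))"
    using wave_add_even by metis
  also have "\<dots> = b n"
  proof -
    define t where "t = cantor_sum (\<lambda>k. b (k + n))"
    have t: "3 * t = 2 * b n + cantor_sum (\<lambda>k. b (k + Suc n))" "t \<in> {0..1}"
      unfolding t_def using cantor_sum_shift cantor_sum_bounds by auto
    consider "b n = 0" "t \<in> {0..1/3}" | "b n = 1" "t \<in> {2/3..1}"
      using digits[of n] cantor_sum_bounds[of "Suc n"] t by fastforce
    then have "wave t = b n"
    proof cases
      case 1
      then have "cos (pi / 3) \<le> cos (pi * t)"
        by (intro cos_monotone_0_pi_le) auto
      with 1 show ?thesis by (simp add: wave_def cos_60)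
    next
      case 2
      then have "cos (pi * t) \<le> cos (2 * pi / 3)"
        by (intro cos_monotone_0_pi_le) (auto simp: field_simps)
      with 2 show ?thesis by (simp add: wave_def cos_120)
    qed
    then show ?thesis by (simp add: t_def)
  qed
  finally show ?thesis .
qed

end

text \<open>Schoenberg's construction: \<open>wave\<close> reads off the ternary digits, and the digits of index
  \<open>prod_encode (j, k)\<close> are the binary digits of the \<open>j\<close>-th coordinate.\<close>

lemma Hilbert_cube_curve:
  obtains c :: "nat \<Rightarrow> real \<Rightarrow> real"
  where "\<And>j. continuous_on UNIV (c j)"
    and "\<And>a. (\<And>j. a j \<in> {0..1}) \<Longrightarrow> \<exists>t\<in>{0..1}. \<forall>j. c j t = a j"
proof
  define c where "c j t = (\<Sum>k. wave (3 ^ prod_encode (j, k) * t) / 2 ^ Suc k)" for j t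
  show "continuous_on UNIV (c j)" for j
  proof (rule uniform_limit_theorem)
    show "uniform_limit UNIV (\<lambda>n t. \<Sum>k<n. wave (3 ^ prod_encode (j, k) * t) / 2 ^ Suc k) (c j) sequentially"
      unfolding c_def
    proof (rule Weierstrass_m_test)
      show "summable (\<lambda>k. (1 / 2 :: real) ^ Suc k)"
        by (simp add: summable_geometric)
      show "norm (wave (3 ^ prod_encode (j, k) * t) / 2 ^ Suc k) \<le> (1 / 2) ^ Suc k" for k t
        using wave_bounds by (simp add: power_divide divide_right_mono)
    qed
  qed (auto intro!: always_eventually continuous_intros)
  fix a :: "nat \<Rightarrow> real"
  assume a: "\<And>j. a j \<in> {0..1}"
  then have "\<forall>j. \<exists>b. (\<forall>k. b k \<in> {0, 1}) \<and> (\<lambda>k. b k / 2 ^ Suc k) sums a j"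
    by (metis binary_expansion)
  then obtain b where b: "\<And>j k. b j k \<in> {0, 1 :: real}" and
    sums: "\<And>j. (\<lambda>k. b j k / 2 ^ Suc k) sums a j"
    by metis
  define d where "d i = (case prod_decode i of (j, k) \<Rightarrow> b j k)" for i
  have d: "d i \<in> {0, 1}" for i
    using b by (simp add: d_def split: prod.split)
  have "c j (cantor_sum d) = a j" for j
    using sums_unique[OF sums[of j]] unfolding c_def wave_cantor_sum[OF d] by (simp add: d_def)
  moreover have "cantor_sum d \<in> {0..1}"
    using cantor_sum_bounds[OF d, where n = 0] by simp
  ultimately show "\<exists>t\<in>{0..1}. \<forall>j. c j t = a j"
    by blast
qed

section \<open>A continuous parametrization of Euclidean space with a Borel section\<close>

text \<open>Through arctan, \<open>G\<close> identifies the space with the open unit cube;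
  \<open>H\<close> follows the curve \<open>C\<close> and then inverts \<open>G\<close>, which is
  continuous on the set \<open>U\<close> of times at which \<open>C\<close> is inside the open cube.
  The last property is what later keeps a weak limit from losing mass at the boundary of
  \<open>U\<close>.\<close>

lemma euclidean_space_curve:
  obtains U :: "real set" and H :: "real \<Rightarrow> 'a::euclidean_space" and \<sigma> :: "'a \<Rightarrow> real"
  where "open U" "continuous_on U H" "H \<in> borel_measurable borel" "\<sigma> \<in> borel_measurable borel"
    and "\<And>z. \<sigma> z \<in> {0..1}" "\<And>z. H (\<sigma> z) = z"
    and "\<And>K. compact K \<Longrightarrow> \<exists>T. closed T \<and> T \<subseteq> U \<and> \<sigma> ` K \<subseteq> T"
proof -
  obtain c :: "nat \<Rightarrow> real \<Rightarrow> real" where c: "\<And>j. continuous_on UNIV (c j)"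
    and c_surj: "\<And>a. (\<And>j. a j \<in> {0..1}) \<Longrightarrow> \<exists>t\<in>{0..1}. \<forall>j. c j t = a j"
    using Hilbert_cube_curve by blast
  obtain e :: "'a \<Rightarrow> nat" where e: "inj_on e Basis"
    using finite_imp_inj_to_nat_seg[OF finite_Basis] by metis
  define C where "C t = (\<Sum>b\<in>Basis. c (e b) t *\<^sub>R b)" for t
  define G where "G z = (\<Sum>b\<in>Basis. (1 / 2 + arctan (z \<bullet> b) / pi) *\<^sub>R b)" for z :: 'a
  define H where "H t = (\<Sum>b\<in>Basis. tan (pi * (c (e b) t - 1 / 2)) *\<^sub>R b)" for t
  define U where "U = (\<Inter>b\<in>Basis. c (e b) -` {0<..<1})"
  define A where "A z = {0..1} \<inter> C -` {G z}" for z
  define \<sigma> where "\<sigma> z = Inf (A z)" for z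
  have [simp]: "C t \<bullet> b = c (e b) t" if "b \<in> Basis" for t b
    using that by (simp add: C_def)
  have [simp]: "G z \<bullet> b = 1 / 2 + arctan (z \<bullet> b) / pi" if "b \<in> Basis" for z b
    using that by (simp add: G_def)
  have G_range: "G z \<bullet> b \<in> {0<..<1}" if "b \<in> Basis" for z b
    using that arctan_bounded[of "z \<bullet> b"] by (simp add: field_simps)
  have contC: "continuous_on UNIV C"
    unfolding C_def by (intro continuous_intros c)
  have contG: "continuous_on UNIV G"
    unfolding G_def by (intro continuous_intros) simp
  have "\<exists>t. t \<in> A z" for z
  proof -
    \<comment> \<open>The curve fills a cube with infinitely many coordinates; those outside the
      range of \<open>e\<close> are padded with 0.\<close>
    define a where "a j = (if j \<in> e ` Basis then G z \<bullet> inv_into Basis e j else 0)" for j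
    have "a j \<in> {0..1}" for j
      using G_range[of "inv_into Basis e j" z] by (auto simp: a_def inv_into_into less_imp_le)
    then obtain t where "t \<in> {0..1}" "\<And>j. c j t = a j"
      using c_surj by blast
    then show ?thesis
      using e by (auto intro!: exI[of _ t] euclidean_eqI[of "C t"] simp: A_def a_def)
  qed
  moreover have "closed (A z)" for z
    unfolding A_def by (intro closed_Int closed_atLeastAtMost closed_vimage contC closed_singleton)
  moreover have bdd: "bdd_below (A z)" for z
    by (rule bdd_belowI[of _ 0]) (simp add: A_def)
  \<comment> \<open>The fibre over \<open>z\<close> is nonempty, closed and bounded below, so its
    infimum is attained.\<close>
  ultimately have \<sigma>: "\<sigma> z \<in> A z" for z
    unfolding \<sigma>_def by (intro closed_contains_Inf) auto
  have UH: "H t = z" if "C t = G z" for t z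
  proof (rule euclidean_eqI)
    fix b :: 'a assume b: "b \<in> Basis"
    have "c (e b) t - 1 / 2 = arctan (z \<bullet> b) / pi"
      using arg_cong[OF that, of "\<lambda>x. x \<bullet> b"] b by simp
    then show "H t \<bullet> b = z \<bullet> b"
      using b by (simp add: H_def tan_arctan)
  qed
  have UG: "t \<in> U" if "C t = G z" for t z
    unfolding U_def
  proof (intro INT_I vimageI2)
    fix b :: 'a assume b: "b \<in> Basis"
    have "c (e b) t = G z \<bullet> b"
      using arg_cong[OF that, of "\<lambda>x. x \<bullet> b"] b by simp
    then show "c (e b) t \<in> {0<..<1}"
      using G_range[OF b] by simp
  qed
  show ?thesis
  proof (rule that)
    show "open U"
      unfolding U_def by (intro open_INT ballI open_vimage c) auto
    have "cos (pi * (c (e b) t - 1 / 2)) \<noteq> 0" if "t \<in> U" "b \<in> Basis" for t b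
    proof -
      have "c (e b) t \<in> {0<..<1}"
        using that by (auto simp: U_def)
      then have "0 < cos (pi * (c (e b) t - 1 / 2))"
        by (intro cos_gt_zero_pi) (auto simp: field_simps)
      then show ?thesis by simp
    qed
    then show "continuous_on U H"
      unfolding H_def by (intro continuous_intros continuous_on_subset[OF c]) auto
    have [measurable]: "c j \<in> borel_measurable borel" for j
      by (intro borel_measurable_continuous_onI c)
    show "H \<in> borel_measurable borel"
      unfolding H_def tan_def by measurable
    show "\<sigma> \<in> borel_measurable borel"
    proof (rule borel_measurableI_le)
      fix a :: real
      \<comment> \<open>The smallest preimage is at most \<open>a\<close> exactly if the curve hits
        \<open>G z\<close> by time \<open>a\<close>. Hence every sublevel set of
        \<open>\<sigma>\<close> is the preimage of a compact set under a continuous map.\<close>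
      have "{z. \<sigma> z \<le> a} = G -` (C ` ({0..1} \<inter> {..a}))"
      proof (intro equalityI subsetI)
        fix z assume "z \<in> {z. \<sigma> z \<le> a}"
        then show "z \<in> G -` (C ` ({0..1} \<inter> {..a}))"
          unfolding vimage_eq using \<sigma>[of z] by (intro image_eqI[of _ _ "\<sigma> z"]) (auto simp: A_def)
      next
        fix z assume "z \<in> G -` (C ` ({0..1} \<inter> {..a}))"
        then obtain t where "G z = C t" "t \<in> {0..1}" "t \<le> a"
          by auto
        then have "\<sigma> z \<le> t"
          unfolding \<sigma>_def by (intro cInf_lower bdd) (simp add: A_def)
        with \<open>t \<le> a\<close> show "z \<in> {z. \<sigma> z \<le> a}" by simp
      qed
      moreover have "compact ({0..1} \<inter> {..a})"
        by (intro compact_Int_closed) auto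
      then have "closed (G -` (C ` ({0..1} \<inter> {..a})))"
        by (intro closed_vimage contG compact_imp_closed compact_continuous_image
          continuous_on_subset[OF contC]) auto
      ultimately show "{z \<in> space borel. \<sigma> z \<le> a} \<in> sets borel"
        by simp
    qed
    show "\<sigma> z \<in> {0..1}" "H (\<sigma> z) = z" for z
      using \<sigma>[of z] UH by (auto simp: A_def)
    fix K :: "'a set" assume "compact K"
    then have "closed (C -` (G ` K))"
      by (intro closed_vimage contC compact_imp_closed compact_continuous_image
        continuous_on_subset[OF contG]) auto
    moreover have "C -` (G ` K) \<subseteq> U" "\<sigma> ` K \<subseteq> C -` (G ` K)"
      using \<sigma> UG by (auto simp: A_def)
    ultimately show "\<exists>T. closed T \<and> T \<subseteq> U \<and> \<sigma> ` K \<subseteq> T"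
      by blast
  qed
qed

section \<open>Sequential compactness of tight families of measures\<close>

text \<open>The images under \<open>\<sigma>\<close> live on \<open>{0..1}\<close>, so Helly's
  theorem yields a limit \<open>M\<close> on the line. Tightness forces \<open>M\<close> to be
  concentrated on \<open>U\<close>, where \<open>H\<close> is continuous, and the image of
  \<open>M\<close> under \<open>H\<close> is the limit sought, because \<open>H\<close> undoes
  \<open>\<sigma>\<close>.\<close>

theorem Prokhorov_sequential:
  fixes \<mu> :: "nat \<Rightarrow> 'a::euclidean_space measure"
  assumes prob: "\<And>k. prob_space (\<mu> k)" and sets: "\<And>k. sets (\<mu> k) = sets borel"
    and tight: "\<And>\<epsilon>. 0 < \<epsilon> \<Longrightarrow> \<exists>K. compact K \<and> (\<forall>k. 1 - \<epsilon> \<le> measure (\<mu> k) K)"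
  obtains r :: "nat \<Rightarrow> nat" and \<nu> where "strict_mono r" "prob_space \<nu>" "sets \<nu> = sets borel"
    and "\<And>(f :: 'a \<Rightarrow> real) B. continuous_on UNIV f \<Longrightarrow> (\<And>x. \<bar>f x\<bar> \<le> B) \<Longrightarrow>
      (\<lambda>k. integral\<^sup>L (\<mu> (r k)) f) \<longlonglongrightarrow> integral\<^sup>L \<nu> f"
proof -
  obtain U :: "real set" and H :: "real \<Rightarrow> 'a" and \<sigma> :: "'a \<Rightarrow> real"
    where U: "open U" and H: "continuous_on U H" and [measurable]: "H \<in> borel_measurable borel"
      "\<sigma> \<in> borel_measurable borel"
      and \<sigma>: "\<And>z. \<sigma> z \<in> {0..1}" and H_\<sigma>: "\<And>z. H (\<sigma> z) = z"
      and compact: "\<And>K. compact K \<Longrightarrow> \<exists>T. closed T \<and> T \<subseteq> U \<and> \<sigma> ` K \<subseteq> T"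
    using euclidean_space_curve by blast
  note [measurable_cong] = sets
  have space [simp]: "space (\<mu> k) = UNIV" for k
    using sets_eq_imp_space_eq[OF sets[of k]] by simp
  define m where "m k = distr (\<mu> k) borel \<sigma>" for k
  have m: "real_distribution (m k)" for k
    unfolding m_def by (intro prob_space.real_distribution_distr prob) measurable
  interpret \<mu>: prob_space "\<mu> k" for k
    by (rule prob)
  have m_measure: "measure (m k) A = measure (\<mu> k) (\<sigma> -` A)" if [measurable]: "A \<in> sets borel" for k A
    unfolding m_def by (subst measure_distr) auto
  \<comment> \<open>Tightness on the line is phrased with half-open intervals; this one contains
    \<open>{0..1}\<close>.\<close>
  have "measure (m k) {-1<..2} = 1" for k
  proof -
    have "\<sigma> z \<in> {-1<..2}" for z
      using \<sigma>[of z] by simp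
    then have "\<sigma> -` {-1<..2} = space (\<mu> k)"
      by auto
    then show ?thesis
      using \<mu>.prob_space[of k] by (simp add: m_measure)
  qed
  then have "Helly_Selection.tight m"
    unfolding Helly_Selection.tight_def using m
    by (intro conjI allI impI exI[of _ "-1 :: real"] exI[of _ "2 :: real"]) auto
  from tight_imp_convergent_subsubsequence[OF this strict_mono_id]
  obtain r M where r: "strict_mono r" and M: "real_distribution M" and "weak_conv_m (m \<circ> id \<circ> r) M"
    by auto
  then have conv: "weak_conv_m (\<lambda>k. m (r k)) M"
    by (simp add: comp_def)
  interpret M: real_distribution M by fact
  interpret m: real_distribution "m k" for k by (rule m)
  \<comment> \<open>Mass of an open set may escape in a weak limit. A Urysohn function that is 1 on
    the closed set \<open>T\<close> and 0 off \<open>U\<close> prevents this: its integrals are at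
    least \<open>1 - \<epsilon>\<close> along the sequence, hence in the limit, and it lies below
    the indicator of \<open>U\<close>.\<close>
  have "1 - \<epsilon> \<le> M.prob U" if \<epsilon>: "0 < \<epsilon>" for \<epsilon>
  proof -
    obtain K where "compact K" and K: "\<And>k. 1 - \<epsilon> \<le> measure (\<mu> k) K"
      using tight[OF \<epsilon>] by blast
    then obtain T where T: "closed T" "T \<subseteq> U" "\<sigma> ` K \<subseteq> T"
      using compact by blast
    obtain f :: "real \<Rightarrow> real" where f: "continuous_on UNIV f" "\<And>x. f x \<in> closed_segment 0 1"
      "\<And>x. x \<in> - U \<Longrightarrow> f x = 0" "\<And>x. x \<in> T \<Longrightarrow> f x = 1"
      using Urysohn[of "- U" T 0 1] T U by (auto simp: closed_Compl)
    then have f_bounds: "0 \<le> f x" "f x \<le> 1" for x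
      using f(2)[of x] by (auto simp: closed_segment_eq_real_ivl)
    have [measurable]: "f \<in> borel_measurable borel"
      using f(1) by (rule borel_measurable_continuous_onI)
    have "1 - \<epsilon> \<le> integral\<^sup>L (m k) f" for k
    proof -
      have "1 - \<epsilon> \<le> measure (\<mu> k) (\<sigma> -` T)"
        using K[of k] T \<open>compact K\<close>
        by (intro order_trans[OF K[of k]] \<mu>.finite_measure_mono)
          (auto simp: sets intro!: measurable_sets_borel[where M = borel])
      also have "\<dots> = integral\<^sup>L (m k) (indicator T)"
        using T by (simp add: m_measure)
      also have "\<dots> \<le> integral\<^sup>L (m k) f"
        using T f f_bounds
        by (intro integral_mono m.integrable_const_bound[where B = 1])
          (auto split: split_indicator intro: borel_closed)
      finally show ?thesis .
    qed
    moreover have "(\<lambda>k. integral\<^sup>L (m (r k)) f) \<longlonglongrightarrow> integral\<^sup>L M f"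
      using f(1) f_bounds
      by (intro weak_conv_imp_integral_bdd_continuous_conv[OF m M conv, where B = 1])
        (auto simp: continuous_on_eq_continuous_at)
    ultimately have "1 - \<epsilon> \<le> integral\<^sup>L M f"
      by (intro LIMSEQ_le_const) auto
    also have "\<dots> \<le> integral\<^sup>L M (indicator U)"
      using f f_bounds U
      by (intro integral_mono M.integrable_const_bound[where B = 1])
        (auto split: split_indicator)
    finally show ?thesis
      using U by simp
  qed
  then have "1 \<le> M.prob U"
    by (meson diff_le_eq field_le_epsilon)
  then have M_U: "M (- U) = 0"
    using M.prob_compl[of U] U M.prob_le_1[of U] by (simp add: M.emeasure_eq_measure Compl_eq_Diff_UNIV)
  show ?thesis
  proof (rule that[OF r])
    show "prob_space (distr M borel H)" "sets (distr M borel H) = sets borel"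
      by (auto intro!: M.prob_space_distr)
    fix f :: "'a \<Rightarrow> real" and B
    assume f: "continuous_on UNIV f" and B: "\<And>x. \<bar>f x\<bar> \<le> B"
    have [measurable]: "f \<in> borel_measurable borel"
      using f by (rule borel_measurable_continuous_onI)
    have "isCont (\<lambda>t. f (H t)) t" if "t \<in> U" for t
      using continuous_on_interior[OF continuous_on_compose2[OF f H]] that U
      by (simp add: interior_open)
    \<comment> \<open>The discontinuities form a null set for the limit, which is enough for weak
      convergence to pass to integrals of this bounded function.\<close>
    then have "M {t. \<not> isCont (\<lambda>t. f (H t)) t} \<le> M (- U)"
      using U by (intro emeasure_mono) auto
    then have "(\<lambda>k. integral\<^sup>L (m (r k)) (\<lambda>t. f (H t))) \<longlonglongrightarrow> integral\<^sup>L M (\<lambda>t. f (H t))"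
      using M_U B by (intro weak_conv_imp_bdd_ae_continuous_conv[OF m M conv]) auto
    moreover have "integral\<^sup>L (m k) (\<lambda>t. f (H t)) = integral\<^sup>L (\<mu> k) f" for k
      unfolding m_def by (subst integral_distr) (auto simp: H_\<sigma>)
    moreover have "integral\<^sup>L (distr M borel H) f = integral\<^sup>L M (\<lambda>t. f (H t))"
      by (rule integral_distr) auto
    ultimately show "(\<lambda>k. integral\<^sup>L (\<mu> (r k)) f) \<longlonglongrightarrow> integral\<^sup>L (distr M borel H) f"
      by simp
  qed
qed

section \<open>Determination by continuous functions, and tightness of one measure\<close>

text \<open>Closed sets form an intersection-stable generator of the Borel sets, and the indicator
  of a nonempty closed set is the pointwise limit of continuous functions that fall off with the
  distance to it.\<close>

lemma measure_eqI_bounded_continuous: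
  fixes M N :: "'a::metric_space measure"
  assumes M: "finite_measure M" "sets M = sets borel" and N: "finite_measure N" "sets N = sets borel"
    and eq: "\<And>f :: 'a \<Rightarrow> real. continuous_on UNIV f \<Longrightarrow> (\<And>x. \<bar>f x\<bar> \<le> 1) \<Longrightarrow>
      integral\<^sup>L M f = integral\<^sup>L N f"
  shows "M = N"
proof (rule measure_eqI_generator_eq[where E = "Collect closed" and \<Omega> = UNIV and A = "\<lambda>_. UNIV"])
  interpret M: finite_measure M by fact
  interpret N: finite_measure N by fact
  show "Int_stable (Collect closed :: 'a set set)"
    by (auto simp: Int_stable_def)
  show "sets M = sigma_sets UNIV (Collect closed)" "sets N = sigma_sets UNIV (Collect closed)"
    using M(2) N(2) by (simp_all add: borel_eq_closed)
  show "emeasure M UNIV \<noteq> \<infinity>"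
    by simp
  fix A :: "'a set" assume "A \<in> Collect closed"
  then have A: "closed A" by simp
  define f where "f n x = max 0 (1 - real n * infdist x A)" for n x
  have f: "continuous_on UNIV (f n)" "\<bar>f n x\<bar> \<le> 1" for n x
    unfolding f_def by (auto intro!: continuous_intros mult_nonneg_nonneg infdist_nonneg)
  \<comment> \<open>The empty set is excluded because \<open>infdist x {}\<close> is 0, which would
    make every \<open>f n\<close> constantly 1.\<close>
  have lim: "(\<lambda>n. integral\<^sup>L K (f n)) \<longlonglongrightarrow> measure K A"
    if "A \<noteq> {}" "finite_measure K" "sets K = sets borel" for K
  proof -
    interpret K: finite_measure K by fact
    have "(\<lambda>n. integral\<^sup>L K (f n)) \<longlonglongrightarrow> integral\<^sup>L K (indicator A)"
    proof (rule integral_dominated_convergence[where w = "\<lambda>_. 1"])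
      show "f n \<in> borel_measurable K" for n
        using borel_measurable_continuous_onI[OF f(1)] measurable_cong_sets[OF that(3) refl] by blast
      show "indicator A \<in> borel_measurable K"
        using A that by (intro borel_measurable_indicator) auto
      have "(\<lambda>n. f n x) \<longlonglongrightarrow> indicator A x" for x
      proof (cases "x \<in> A")
        case False
        then have "0 < infdist x A"
          using A \<open>A \<noteq> {}\<close> by (simp add: infdist_pos_not_in_closed)
        then obtain n0 where "1 < real n0 * infdist x A"
          using ex_less_of_nat_mult by blast
        then have "1 \<le> real n * infdist x A" if "n0 \<le> n" for n
          using that \<open>0 < infdist x A\<close>
          by (smt (verit) mult_right_mono of_nat_mono)
        then have "f n x = 0" if "n0 \<le> n" for n
          using that by (simp add: f_def)
        then show ?thesis
          using False by (auto intro!: tendsto_eventually eventually_sequentiallyI[of n0])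
      qed (simp add: f_def)
      then show "AE x in K. (\<lambda>n. f n x) \<longlonglongrightarrow> indicator A x"
        by simp
      show "AE x in K. norm (f n x) \<le> 1" for n
        using f(2) by simp
    qed simp
    also have "integral\<^sup>L K (indicator A) = measure K A"
      using A that by simp
    finally show ?thesis .
  qed
  show "emeasure M A = emeasure N A"
  proof (cases "A = {}")
    case False
    have "measure M A = measure N A"
      using LIMSEQ_unique[OF lim[OF False M] lim[OF False N, folded eq[OF f]]] .
    then show ?thesis
      by (simp add: M.emeasure_eq_measure N.emeasure_eq_measure)
  qed simp
qed auto

text \<open>Closed balls of integer radius are compact and exhaust the space, so continuity from
  below applies.\<close>

lemma prob_space_tight:
  fixes P :: "'a::euclidean_space measure"
  assumes "prob_space P" "sets P = sets borel" "0 < \<epsilon>"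
  obtains K where "compact K" "1 - \<epsilon> \<le> measure P K"
proof -
  interpret prob_space P by fact
  have "(\<lambda>n. prob (cball 0 (real n))) \<longlonglongrightarrow> prob (\<Union>n. cball 0 (real n))"
  proof (rule finite_Lim_measure_incseq)
    show "range (\<lambda>n. cball 0 (real n)) \<subseteq> events"
      unfolding assms(2) by auto
    show "incseq (\<lambda>n. cball (0 :: 'a) (real n))"
      by (intro incseq_SucI subset_cball) simp
  qed
  also have "(\<Union>n. cball (0 :: 'a) (real n)) = space P"
    unfolding sets_eq_imp_space_eq[OF assms(2)] by (auto intro: real_arch_simple)
  finally have "\<forall>\<^sub>F n in sequentially. 1 - \<epsilon> < prob (cball 0 (real n))"
    using \<open>0 < \<epsilon>\<close> by (intro order_tendstoD) (auto simp: prob_space)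
  then obtain n where "1 - \<epsilon> < prob (cball 0 (real n))"
    using eventually_sequentially by auto
  then show thesis
    using that[of "cball 0 (real n)"] by simp
qed

section \<open>Couplings and their uniform tightness\<close>

text \<open>Replaces the product sigma-algebra by the Borel sets of the product space, the form that
  the topological results require.\<close>

lemma couplingsD:
  assumes "\<kappa> \<in> couplings P Q"
  shows "sets \<kappa> = sets borel" "distr \<kappa> borel fst = P" "distr \<kappa> borel snd = Q"
  using assms unfolding couplings_def borel_prod by simp_all

lemma couplings_measurable:
  assumes "\<kappa> \<in> couplings P Q"
  shows "fst \<in> \<kappa> \<rightarrow>\<^sub>M borel" "snd \<in> \<kappa> \<rightarrow>\<^sub>M borel"
proof -
  have "sets \<kappa> = sets (borel \<Otimes>\<^sub>M borel)"
    using assms by (simp add: couplings_def)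
  note [measurable_cong] = this
  show "fst \<in> \<kappa> \<rightarrow>\<^sub>M borel" "snd \<in> \<kappa> \<rightarrow>\<^sub>M borel"
    by measurable
qed

lemma couplings_prob_space:
  assumes "\<kappa> \<in> couplings P Q" "prob_space P"
  shows "prob_space \<kappa>"
  using prob_space_distrD[OF couplings_measurable(1)[OF assms(1)]] couplingsD(2)[OF assms(1)] assms(2)
  by simp

lemma pair_measure_in_couplings:
  assumes "prob_space P" "sets P = sets borel" "prob_space Q" "sets Q = sets borel"
  shows "P \<Otimes>\<^sub>M Q \<in> couplings P Q"
proof -
  interpret P: prob_space P by fact
  interpret Q: prob_space Q by fact
  note [measurable_cong] = assms(2,4)
  have [simp]: "space P = UNIV" "space Q = UNIV"
    using assms(2,4)[THEN sets_eq_imp_space_eq] by auto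
  have "distr (P \<Otimes>\<^sub>M Q) borel fst = P"
  proof (rule measure_eqI)
    fix A assume "A \<in> sets (distr (P \<Otimes>\<^sub>M Q) borel fst)"
    then have A: "A \<in> sets P" using assms by simp
    then have "emeasure (distr (P \<Otimes>\<^sub>M Q) borel fst) A = emeasure (P \<Otimes>\<^sub>M Q) (A \<times> space Q)"
      using assms by (subst emeasure_distr) (auto simp: space_pair_measure intro!: arg_cong[where f = "emeasure _"])
    then show "emeasure (distr (P \<Otimes>\<^sub>M Q) borel fst) A = emeasure P A"
      using A by (simp add: Q.emeasure_pair_measure_Times Q.emeasure_space_1 del: \<open>space Q = UNIV\<close>)
  qed (simp add: assms)
  moreover have "distr (P \<Otimes>\<^sub>M Q) borel snd = Q"
  proof (rule measure_eqI)
    fix A assume "A \<in> sets (distr (P \<Otimes>\<^sub>M Q) borel snd)"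
    then have A: "A \<in> sets Q" using assms by simp
    then have "emeasure (distr (P \<Otimes>\<^sub>M Q) borel snd) A = emeasure (P \<Otimes>\<^sub>M Q) (space P \<times> A)"
      using assms by (subst emeasure_distr) (auto simp: space_pair_measure intro!: arg_cong[where f = "emeasure _"])
    then show "emeasure (distr (P \<Otimes>\<^sub>M Q) borel snd) A = emeasure Q A"
      using A by (simp add: Q.emeasure_pair_measure_Times P.emeasure_space_1 del: \<open>space P = UNIV\<close>)
  qed (simp add: assms)
  ultimately show ?thesis
    unfolding couplings_def using assms by (auto intro: sets_pair_measure_cong)
qed

text \<open>Only the marginals matter: compact sets that miss at most \<open>\<epsilon> / 2\<close>
  of \<open>P\<close> and of \<open>Q\<close> have a product that misses at most
  \<open>\<epsilon>\<close> of any coupling, by inclusion-exclusion.\<close>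

lemma couplings_uniformly_tight:
  fixes P Q :: "(real ^ 'n) measure"
  assumes P: "prob_space P" "sets P = sets borel" and Q: "prob_space Q" "sets Q = sets borel"
    and "0 < \<epsilon>"
  shows "\<exists>K. compact K \<and> (\<forall>\<kappa>\<in>couplings P Q. 1 - \<epsilon> \<le> measure \<kappa> K)"
proof -
  obtain A B :: "(real ^ 'n) set" where A: "compact A" "1 - \<epsilon> / 2 \<le> measure P A"
    and B: "compact B" "1 - \<epsilon> / 2 \<le> measure Q B"
    using prob_space_tight[OF P] prob_space_tight[OF Q] \<open>0 < \<epsilon>\<close> by (metis half_gt_zero)
  have "1 - \<epsilon> \<le> measure \<kappa> (A \<times> B)" if \<kappa>: "\<kappa> \<in> couplings P Q" for \<kappa>
  proof -
    interpret prob_space \<kappa>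
      using couplings_prob_space[OF \<kappa> P(1)] .
    note meas = couplings_measurable[OF \<kappa>]
    have space: "space \<kappa> = UNIV"
      using sets_eq_imp_space_eq[OF couplingsD(1)[OF \<kappa>]] by simp
    have sets: "A \<times> UNIV \<in> events" "UNIV \<times> B \<in> events"
      unfolding couplingsD(1)[OF \<kappa>]
      by (intro borel_closed closed_Times closed_UNIV compact_imp_closed[OF A(1)] compact_imp_closed[OF B(1)])+
    have "measure P A = prob (A \<times> UNIV)"
      using A measure_distr[OF meas(1), of A] couplingsD(2)[OF \<kappa>]
      by (auto simp: space borel_compact fst_vimage_eq_Times)
    moreover have "measure Q B = prob (UNIV \<times> B)"
      using B measure_distr[OF meas(2), of B] couplingsD(3)[OF \<kappa>]
      by (auto simp: space borel_compact snd_vimage_eq_Times)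
    moreover have "prob (A \<times> UNIV \<union> UNIV \<times> B) = prob (A \<times> UNIV) + prob (UNIV \<times> B) - prob (A \<times> B)"
      using measure_Un3[OF _ _, of "A \<times> UNIV" \<kappa> "UNIV \<times> B"] sets
      by (simp add: Times_Int_Times fmeasurable_eq_sets)
    moreover have "prob (A \<times> UNIV \<union> UNIV \<times> B) \<le> 1"
      by simp
    ultimately show ?thesis
      using A B by simp
  qed
  then show ?thesis
    using A B by (auto intro: compact_Times)
qed

lemma integral_couplings:
  fixes f :: "real ^ 'n \<Rightarrow> real"
  assumes "\<kappa> \<in> couplings P Q" "f \<in> borel_measurable borel"
  shows "(LINT z|\<kappa>. f (fst z)) = integral\<^sup>L P f" "(LINT z|\<kappa>. f (snd z)) = integral\<^sup>L Q f"
    and "integrable \<kappa> (\<lambda>z. f (fst z)) \<longleftrightarrow> integrable P f"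
    and "integrable \<kappa> (\<lambda>z. f (snd z)) \<longleftrightarrow> integrable Q f"
  using integral_distr[OF couplings_measurable(1)[OF assms(1)] assms(2)]
    integral_distr[OF couplings_measurable(2)[OF assms(1)] assms(2)]
    integrable_distr_eq[OF couplings_measurable(1)[OF assms(1)] assms(2)]
    integrable_distr_eq[OF couplings_measurable(2)[OF assms(1)] assms(2)]
  unfolding couplingsD(2,3)[OF assms(1)] by simp_all

section \<open>Existence of an optimal coupling\<close>

text \<open>Direct method: a minimizing sequence of couplings has a weakly convergent subsequence,
  its limit has the same marginals, and the cost is lower semicontinuous along it.\<close>

theorem optimal_coupling_exists:
  fixes P Q :: "(real ^ 'n) measure" and c :: "(real ^ 'n) \<times> (real ^ 'n) \<Rightarrow> real"
  assumes P: "prob_space P" "sets P = sets borel" and Q: "prob_space Q" "sets Q = sets borel"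
    and c: "continuous_on UNIV c" "\<And>z. 0 \<le> c z"
    and int: "\<And>\<kappa>. \<kappa> \<in> couplings P Q \<Longrightarrow> integrable \<kappa> c"
  obtains \<kappa> where "\<kappa> \<in> couplings P Q"
    "integral\<^sup>L \<kappa> c = (INF \<kappa>\<in>couplings P Q. integral\<^sup>L \<kappa> c)"
proof -
  define W where "W = (INF \<kappa>\<in>couplings P Q. integral\<^sup>L \<kappa> c)"
  have ne: "couplings P Q \<noteq> {}"
    using pair_measure_in_couplings[OF P Q] by blast
  have bdd: "bdd_below ((\<lambda>\<kappa>. integral\<^sup>L \<kappa> c) ` couplings P Q)"
    using c(2) by (intro bdd_belowI2[of _ 0]) simp
  have "\<exists>\<kappa>\<in>couplings P Q. integral\<^sup>L \<kappa> c < W + inverse (real (Suc k))" for k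
    using cINF_less_iff[OF ne bdd, of "W + inverse (real (Suc k))"] by (simp add: W_def)
  then obtain \<kappa> where \<kappa>: "\<And>k. \<kappa> k \<in> couplings P Q"
    and W: "\<And>k. integral\<^sup>L (\<kappa> k) c < W + inverse (real (Suc k))"
    by metis
  obtain r \<nu> where r: "strict_mono (r :: nat \<Rightarrow> nat)" and \<nu>: "prob_space \<nu>" "sets \<nu> = sets borel"
    and conv: "\<And>(f :: (real ^ 'n) \<times> (real ^ 'n) \<Rightarrow> real) B. continuous_on UNIV f \<Longrightarrow> (\<And>x. \<bar>f x\<bar> \<le> B) \<Longrightarrow>
      (\<lambda>k. integral\<^sup>L (\<kappa> (r k)) f) \<longlonglongrightarrow> integral\<^sup>L \<nu> f"
  proof (rule Prokhorov_sequential[of \<kappa>])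
    show "prob_space (\<kappa> k)" "sets (\<kappa> k) = sets borel" for k
      using couplings_prob_space[OF \<kappa> P(1)] couplingsD(1)[OF \<kappa>] by auto
    show "\<exists>K. compact K \<and> (\<forall>k. 1 - \<epsilon> \<le> measure (\<kappa> k) K)" if "0 < \<epsilon>" for \<epsilon>
      using couplings_uniformly_tight[OF P Q that] \<kappa> by blast
  qed blast
  interpret \<nu>: prob_space \<nu> by fact
  have sets_\<nu>: "sets \<nu> = sets (borel \<Otimes>\<^sub>M borel)"
    unfolding \<nu>(2) borel_prod ..
  note [measurable_cong] = this
  have "distr \<nu> borel fst = P"
  proof (rule measure_eqI_bounded_continuous)
    fix f :: "real ^ 'n \<Rightarrow> real"
    assume f: "continuous_on UNIV f" "\<And>x. \<bar>f x\<bar> \<le> 1"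
    have [measurable]: "f \<in> borel_measurable borel"
      using f(1) by (rule borel_measurable_continuous_onI)
    \<comment> \<open>This sequence is constant, since each term is the integral of \<open>f\<close>
      against \<open>P\<close>; its limit must be that integral too.\<close>
    have "(\<lambda>k. LINT z|\<kappa> (r k). f (fst z)) \<longlonglongrightarrow> (LINT z|\<nu>. f (fst z))"
      using f by (intro conv continuous_on_compose2[OF f(1)] continuous_intros) auto
    then show "integral\<^sup>L (distr \<nu> borel fst) f = integral\<^sup>L P f"
      by (simp add: integral_couplings(1)[OF \<kappa>] LIMSEQ_const_iff integral_distr)
  qed (use P in \<open>auto intro!: prob_space.finite_measure \<nu>.prob_space_distr\<close>)
  moreover have "distr \<nu> borel snd = Q"
  proof (rule measure_eqI_bounded_continuous)
    fix f :: "real ^ 'n \<Rightarrow> real"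
    assume f: "continuous_on UNIV f" "\<And>x. \<bar>f x\<bar> \<le> 1"
    have [measurable]: "f \<in> borel_measurable borel"
      using f(1) by (rule borel_measurable_continuous_onI)
    have "(\<lambda>k. LINT z|\<kappa> (r k). f (snd z)) \<longlonglongrightarrow> (LINT z|\<nu>. f (snd z))"
      using f by (intro conv continuous_on_compose2[OF f(1)] continuous_intros) auto
    then show "integral\<^sup>L (distr \<nu> borel snd) f = integral\<^sup>L Q f"
      by (simp add: integral_couplings(2)[OF \<kappa>] LIMSEQ_const_iff integral_distr)
  qed (use Q in \<open>auto intro!: prob_space.finite_measure \<nu>.prob_space_distr\<close>)
  ultimately have \<nu>_coupling: "\<nu> \<in> couplings P Q"
    using sets_\<nu> by (simp add: couplings_def)
  have c_meas: "c \<in> borel_measurable borel"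
    using c(1) by (rule borel_measurable_continuous_onI)
  \<comment> \<open>Weak convergence handles bounded functions only, so the cost is truncated at
    \<open>N\<close>. The bound by \<open>W\<close> survives the limit in \<open>k\<close> for each
    \<open>N\<close>, and then dominated convergence in \<open>N\<close> applies with
    \<open>c\<close> itself as the majorant, integrable because the limit is a coupling.\<close>
  define cN where "cN N z = min (c z) (real N)" for N z
  have cN_meas: "cN N \<in> borel_measurable \<nu>" for N
    unfolding cN_def measurable_cong_sets[OF \<nu>(2) refl] using c_meas by measurable
  have "integral\<^sup>L \<nu> (cN N) \<le> W" for N
  proof (rule LIMSEQ_le)
    show "(\<lambda>k. integral\<^sup>L (\<kappa> (r k)) (cN N)) \<longlonglongrightarrow> integral\<^sup>L \<nu> (cN N)"
      unfolding cN_def using c by (intro conv[where B = "real N"] continuous_intros) auto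
    have "(\<lambda>k. W + inverse (real (Suc k))) \<longlonglongrightarrow> W"
      using tendsto_add[OF tendsto_const LIMSEQ_inverse_real_of_nat, of W] by simp
    from LIMSEQ_subseq_LIMSEQ[OF this r]
    show "(\<lambda>k. W + inverse (real (Suc (r k)))) \<longlonglongrightarrow> W"
      by (simp add: comp_def)
    have "integral\<^sup>L (\<kappa> k) (cN N) \<le> integral\<^sup>L (\<kappa> k) c" for k
      by (rule integral_mono'[OF int[OF \<kappa>]]) (auto simp: cN_def c)
    then show "\<exists>n. \<forall>k\<ge>n. integral\<^sup>L (\<kappa> (r k)) (cN N) \<le> W + inverse (real (Suc (r k)))"
      using W by (meson less_imp_le order_trans)
  qed
  moreover have "(\<lambda>N. integral\<^sup>L \<nu> (cN N)) \<longlonglongrightarrow> integral\<^sup>L \<nu> c"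
  proof (rule integral_dominated_convergence[where w = c])
    have "(\<lambda>N. cN N z) \<longlonglongrightarrow> c z" for z
    proof -
      obtain N where "c z \<le> real N"
        using real_arch_simple by blast
      then show ?thesis
        by (intro tendsto_eventually eventually_sequentiallyI[of N]) (auto simp: cN_def)
    qed
    then show "AE z in \<nu>. (\<lambda>N. cN N z) \<longlonglongrightarrow> c z"
      by simp
    show "AE z in \<nu>. norm (cN N z) \<le> c z" for N
      using c(2) by (simp add: cN_def)
  qed (use int[OF \<nu>_coupling] cN_meas in auto)
  ultimately have "integral\<^sup>L \<nu> c \<le> W"
    by (intro LIMSEQ_le_const2) auto
  moreover have "W \<le> integral\<^sup>L \<nu> c"
    unfolding W_def by (rule cINF_lower[OF bdd \<nu>_coupling])
  ultimately show thesis
    using that[OF \<nu>_coupling] by (simp add: W_def)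
qed

section \<open>The equivalence of dominance and the transport bound\<close>

text \<open>Serves to drop the restriction to \<open>D\<close> or \<open>D \<times> D\<close>, on
  which the measures are concentrated.\<close>

lemma set_integral_eq_integral_AE:
  fixes f :: "'a \<Rightarrow> real"
  assumes "AE x in M. x \<in> A" "A \<in> sets M" "f \<in> borel_measurable M"
  shows "(LINT x:A|M. f x) = integral\<^sup>L M f"
  unfolding set_lebesgue_integral_def
proof (rule integral_cong_AE)
  show "AE x in M. indicat_real A x *\<^sub>R f x = f x"
    using assms(1) by eventually_elim simp
qed (use assms in auto)

lemma l1_norm_le_norm: "l1_norm x \<le> real CARD('n) * norm (x :: real ^ 'n)"
  using sum_bounded_above[of UNIV "\<lambda>i. \<bar>x $ i\<bar>" "norm x"] component_le_norm_cart[of x]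
  by (simp add: l1_norm_def)

theorem corollary2p3:
  fixes D :: "(real ^ 'n) set"
    and P Q :: "(real ^ 'n) measure"
    and M :: "'t measure"
    and s :: "'t \<Rightarrow> real ^ 'n \<Rightarrow> real"
    and L \<gamma> :: real
  assumes "D \<noteq> {}" and "D \<in> sets borel"
    and "sets P = sets borel" and "prob_space P" and "emeasure P D = 1"
    and "integrable P (\<lambda>x. norm x)"
    and "sets Q = sets borel" and "prob_space Q" and "emeasure Q D = 1"
    and "integrable Q (\<lambda>x. norm x)"
    and "finite_measure M"
    and "(\<lambda>(\<theta>, x). s \<theta> x) \<in> borel_measurable (M \<Otimes>\<^sub>M borel)"
    and "\<And>\<theta>. \<theta> \<in> space M \<Longrightarrow> mono (s \<theta>)"
    and "integrable M (\<lambda>\<theta>. \<bar>s \<theta> 0\<bar>)"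
    and "\<And>x y. integrable M (\<lambda>\<theta>. \<bar>s \<theta> x - s \<theta> y\<bar>)"
    and "\<And>x y. (LINT \<theta>|M. \<bar>s \<theta> x - s \<theta> y\<bar>) \<le> L * l1_norm (x - y)"
    and "0 \<le> \<gamma>" and "\<gamma> \<le> 1"
  shows "CSD D M s \<gamma> P Q \<longleftrightarrow> Delta D M s P Q \<ge> (1 - \<gamma>) / (1 + \<gamma>) * W_dist D M s P Q"
proof -
  note P = assms(4,3) and Q = assms(8,7) and norm_P = assms(6) and norm_Q = assms(10)
  note int_abs_diff = assms(15) and Lip = assms(16) and \<gamma> = assms(17,18)
  interpret P: prob_space P by fact
  interpret Q: prob_space Q by fact
  define S where "S = S_int M s"
  define d where "d z = d_cost M s (fst z) (snd z)" for z
  \<comment> \<open>A Lipschitz constant for the Euclidean norm: the dimension comes from bounding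
    \<open>l1_norm\<close> by \<open>norm\<close>, and the absolute value makes the constant
    nonnegative.\<close>
  define K where "K = \<bar>L\<bar> * real CARD('n)"

  have [measurable]: "(\<lambda>\<theta>. s \<theta> x) \<in> borel_measurable M" for x
    using measurable_compose[OF measurable_Pair2'[of x borel M] assms(12)] by simp
  have int_s: "integrable M (\<lambda>\<theta>. s \<theta> x)" for x
    by (rule Bochner_Integration.integrable_bound
      [OF Bochner_Integration.integrable_add[OF assms(14) int_abs_diff[of x 0]]]) auto

  have K: "0 \<le> K"
    by (simp add: K_def)
  have d_le: "d (x, y) \<le> K * norm (x - y)" for x y
  proof -
    have "d (x, y) \<le> L * l1_norm (x - y)"
      using Lip by (simp add: d_def d_cost_def)
    also have "\<dots> \<le> \<bar>L\<bar> * l1_norm (x - y)"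
      by (intro mult_right_mono) (auto simp: l1_norm_def sum_nonneg)
    also have "\<dots> \<le> \<bar>L\<bar> * (real CARD('n) * norm (x - y))"
      by (intro mult_left_mono l1_norm_le_norm) simp
    finally show ?thesis
      by (simp add: K_def mult.assoc)
  qed
  have d_nonneg: "0 \<le> d z" for z
    by (simp add: d_def d_cost_def)
  have d_diff: "d (x, y) - d (x', y') \<le> d (x, x') + d (y, y')" for x y x' y'
  proof -
    have "d (x, y) \<le> (LINT \<theta>|M. \<bar>s \<theta> x' - s \<theta> y'\<bar> + \<bar>s \<theta> x - s \<theta> x'\<bar> + \<bar>s \<theta> y - s \<theta> y'\<bar>)"
      unfolding d_def d_cost_def fst_conv snd_conv
      by (intro integral_mono Bochner_Integration.integrable_add int_abs_diff) auto
    also have "\<dots> = d (x', y') + d (x, x') + d (y, y')"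
      by (simp add: d_def d_cost_def int_abs_diff)
    finally show ?thesis by simp
  qed
  \<comment> \<open>One \<open>K\<close> for each of the two arguments, whose distances are at most
    the distance in the product space.\<close>
  have "(2 * K)-lipschitz_on UNIV d"
  proof (rule lipschitz_onI)
    fix z w :: "(real ^ 'n) \<times> (real ^ 'n)"
    obtain x y x' y' where zw: "z = (x, y)" "w = (x', y')"
      by (cases z, cases w) auto
    have "\<bar>d z - d w\<bar> \<le> K * norm (x - x') + K * norm (y - y')"
      using d_diff[of x y x' y'] d_diff[of x' y' x y] d_le[of x x'] d_le[of y y'] d_le[of x' x] d_le[of y' y]
      unfolding zw by (simp add: norm_minus_commute)
    also have "\<dots> \<le> K * dist z w + K * dist z w"
      unfolding zw using dist_fst_le[of z w] dist_snd_le[of z w] K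
      by (intro add_mono mult_left_mono) (auto simp: zw dist_norm)
    finally show "dist (d z) (d w) \<le> 2 * K * dist z w"
      by (simp add: dist_real_def)
  qed (use K in simp)
  then have cont_d: "continuous_on UNIV d"
    by (rule lipschitz_on_continuous_on)
  have S_diff: "\<bar>S x - S y\<bar> \<le> d (x, y)" for x y
  proof -
    have "S x - S y = (LINT \<theta>|M. s \<theta> x - s \<theta> y)"
      by (simp add: S_def S_int_def int_s)
    then show ?thesis
      by (simp add: d_def d_cost_def)
  qed
  have "K-lipschitz_on UNIV S"
    using order_trans[OF S_diff d_le] K by (intro lipschitz_onI) (auto simp: dist_norm)
  then have [measurable]: "S \<in> borel_measurable borel"
    by (intro borel_measurable_continuous_onI lipschitz_on_continuous_on)
  have [measurable]: "d \<in> borel_measurable borel"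
    using cont_d by (rule borel_measurable_continuous_onI)

  \<comment> \<open>Linear growth makes the finite first moments sufficient for
    integrability.\<close>
  have S_bound: "\<bar>S x\<bar> \<le> \<bar>S 0\<bar> + K * norm x" for x
    using S_diff[of x 0] d_le[of x 0] by simp
  have int_S: "integrable R S"
    if "prob_space R" "sets R = sets borel" "integrable R (\<lambda>x. norm x)" for R
  proof (rule Bochner_Integration.integrable_bound)
    interpret prob_space R by fact
    show "integrable R (\<lambda>x. \<bar>S 0\<bar> + K * norm x)"
      using that by simp
    show "S \<in> borel_measurable R"
      unfolding measurable_cong_sets[OF that(2) refl] by measurable
  qed (use S_bound K in auto)

  \<comment> \<open>The positive part of a real is half the sum of its absolute value and itself;
    integration over the parameter turns these into \<open>d\<close> and a difference of
    \<open>S\<close>.\<close>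
  have pos_part: "(LINT \<theta>|M. max (s \<theta> x - s \<theta> y) 0) = (d (x, y) + S x - S y) / 2" for x y
  proof -
    have eq: "max (s \<theta> x - s \<theta> y) 0 = (\<bar>s \<theta> x - s \<theta> y\<bar> + s \<theta> x - s \<theta> y) / 2" for \<theta>
      by (simp add: max_def)
    show ?thesis
      unfolding eq by (simp add: d_def d_cost_def S_def S_int_def int_s int_abs_diff)
  qed
  have d_commute: "d (x, y) = d (y, x)" for x y
    by (simp add: d_def d_cost_def abs_minus_commute)

  have AE_P: "AE x in P. x \<in> D" and AE_Q: "AE x in Q. x \<in> D"
    using assms by (auto intro!: P.AE_prob_1 Q.AE_prob_1 simp: measure_def)
  have Delta: "Delta D M s P Q = integral\<^sup>L Q S - integral\<^sup>L P S"
    unfolding Delta_def S_def[symmetric]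
    using assms(2,3,7) AE_P AE_Q
    by (subst (1 2) set_integral_eq_integral_AE)
      (auto simp: measurable_cong_sets[OF assms(3) refl] measurable_cong_sets[OF assms(7) refl])

  have coupling: "integrable \<kappa> d"
    "(LINT z:D \<times> D|\<kappa>. d z) = integral\<^sup>L \<kappa> d"
    "(LINT z:D \<times> D|\<kappa>. (LINT \<theta>|M. max (s \<theta> (fst z) - s \<theta> (snd z)) 0)) = (integral\<^sup>L \<kappa> d - Delta D M s P Q) / 2"
    "(LINT z:D \<times> D|\<kappa>. (LINT \<theta>|M. max (s \<theta> (snd z) - s \<theta> (fst z)) 0)) = (integral\<^sup>L \<kappa> d + Delta D M s P Q) / 2"
    if \<kappa>: "\<kappa> \<in> couplings P Q" for \<kappa>
  proof -
    note [measurable] = couplings_measurable[OF \<kappa>]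
    note sets = couplingsD(1)[OF \<kappa>]
    note [measurable_cong] = sets
    have S_int: "integrable \<kappa> (\<lambda>z. S (fst z))" "integrable \<kappa> (\<lambda>z. S (snd z))"
      using int_S[OF P norm_P] int_S[OF Q norm_Q] by (simp_all add: integral_couplings[OF \<kappa>])
    have "integrable \<kappa> (\<lambda>z. K * norm (fst z) + K * norm (snd z))"
      using norm_P norm_Q integral_couplings(3,4)[OF \<kappa>, of norm]
      by (intro Bochner_Integration.integrable_add integrable_mult_right) auto
    then show d_int: "integrable \<kappa> d"
    proof (rule Bochner_Integration.integrable_bound)
      have "d z \<le> K * norm (fst z) + K * norm (snd z)" for z
        using d_le[of "fst z" "snd z"] mult_left_mono[OF norm_triangle_ineq4[of "fst z" "snd z"] K]
        by (simp add: distrib_left)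
      then show "AE z in \<kappa>. norm (d z) \<le> norm (K * norm (fst z) + K * norm (snd z))"
        using d_nonneg by (intro AE_I2) (smt (verit) real_norm_def)
    qed measurable
    have "AE z in \<kappa>. fst z \<in> D"
      using AE_distrD[OF couplings_measurable(1)[OF \<kappa>]] AE_P
      unfolding couplingsD(2)[OF \<kappa>] by blast
    moreover have "AE z in \<kappa>. snd z \<in> D"
      using AE_distrD[OF couplings_measurable(2)[OF \<kappa>]] AE_Q
      unfolding couplingsD(3)[OF \<kappa>] by blast
    ultimately have AE: "AE z in \<kappa>. z \<in> D \<times> D"
      by eventually_elim (simp add: mem_Times_iff)
    have DD: "D \<times> D \<in> sets \<kappa>"
      unfolding sets using assms(2) by (metis borel_prod pair_measureI)
    note restrict = set_integral_eq_integral_AE[OF AE DD]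
    show "(LINT z:D \<times> D|\<kappa>. d z) = integral\<^sup>L \<kappa> d"
      by (rule restrict) measurable
    have fst_eq: "(LINT \<theta>|M. max (s \<theta> (fst z) - s \<theta> (snd z)) 0) = (d z + S (fst z) - S (snd z)) / 2" for z
      by (simp add: pos_part)
    have "(LINT z:D \<times> D|\<kappa>. (LINT \<theta>|M. max (s \<theta> (fst z) - s \<theta> (snd z)) 0))
      = (LINT z|\<kappa>. (d z + S (fst z) - S (snd z)) / 2)"
      unfolding fst_eq by (rule restrict) measurable
    then show "(LINT z:D \<times> D|\<kappa>. (LINT \<theta>|M. max (s \<theta> (fst z) - s \<theta> (snd z)) 0)) = (integral\<^sup>L \<kappa> d - Delta D M s P Q) / 2"
      using S_int d_int by (simp add: Delta integral_couplings[OF \<kappa>])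
    have snd_eq: "(LINT \<theta>|M. max (s \<theta> (snd z) - s \<theta> (fst z)) 0) = (d z + S (snd z) - S (fst z)) / 2" for z
      by (simp add: pos_part d_commute[of "snd z"])
    have "(LINT z:D \<times> D|\<kappa>. (LINT \<theta>|M. max (s \<theta> (snd z) - s \<theta> (fst z)) 0))
      = (LINT z|\<kappa>. (d z + S (snd z) - S (fst z)) / 2)"
      unfolding snd_eq by (rule restrict) measurable
    then show "(LINT z:D \<times> D|\<kappa>. (LINT \<theta>|M. max (s \<theta> (snd z) - s \<theta> (fst z)) 0)) = (integral\<^sup>L \<kappa> d + Delta D M s P Q) / 2"
      using S_int d_int by (simp add: Delta integral_couplings[OF \<kappa>])
  qed

  have W: "W_dist D M s P Q = (INF \<kappa>\<in>couplings P Q. integral\<^sup>L \<kappa> d)"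
    unfolding W_dist_def d_def[symmetric] by (intro INF_cong refl coupling(2))
  \<comment> \<open>Only the positive number \<open>1 + \<gamma>\<close> is divided by, so
    \<open>\<gamma> = 1\<close> needs no separate case.\<close>
  have threshold: "(w - \<Delta>) / 2 \<le> \<gamma> * ((w + \<Delta>) / 2) \<longleftrightarrow> (1 - \<gamma>) / (1 + \<gamma>) * w \<le> \<Delta>" for w \<Delta>
  proof -
    have "(w - \<Delta>) / 2 \<le> \<gamma> * ((w + \<Delta>) / 2) \<longleftrightarrow> (1 - \<gamma>) * w \<le> \<Delta> * (1 + \<gamma>)"
      by argo
    then show ?thesis
      using \<gamma> by (simp add: pos_divide_le_eq)
  qed
  have CSD: "CSD D M s \<gamma> P Q \<longleftrightarrow>
      (\<exists>\<kappa>\<in>couplings P Q. (1 - \<gamma>) / (1 + \<gamma>) * integral\<^sup>L \<kappa> d \<le> Delta D M s P Q)"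
    unfolding CSD_def by (intro bex_cong refl) (simp only: coupling threshold)
  show ?thesis
  proof
    assume "CSD D M s \<gamma> P Q"
    then obtain \<kappa> where \<kappa>: "\<kappa> \<in> couplings P Q"
      "(1 - \<gamma>) / (1 + \<gamma>) * integral\<^sup>L \<kappa> d \<le> Delta D M s P Q"
      unfolding CSD by blast
    have "W_dist D M s P Q \<le> integral\<^sup>L \<kappa> d"
      unfolding W using d_nonneg by (intro cINF_lower[OF _ \<kappa>(1)] bdd_belowI2[of _ 0]) simp
    then have "(1 - \<gamma>) / (1 + \<gamma>) * W_dist D M s P Q \<le> (1 - \<gamma>) / (1 + \<gamma>) * integral\<^sup>L \<kappa> d"
      using \<gamma> by (intro mult_left_mono) auto
    with \<kappa>(2) show "(1 - \<gamma>) / (1 + \<gamma>) * W_dist D M s P Q \<le> Delta D M s P Q"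
      by simp
  next
    assume "(1 - \<gamma>) / (1 + \<gamma>) * W_dist D M s P Q \<le> Delta D M s P Q"
    \<comment> \<open>Attainment of the infimum is essential here: when the bound holds with
      equality, an approximate minimizer could violate it.\<close>
    moreover obtain \<kappa> where "\<kappa> \<in> couplings P Q" "integral\<^sup>L \<kappa> d = W_dist D M s P Q"
      using optimal_coupling_exists[OF P Q cont_d d_nonneg coupling(1)] unfolding W by blast
    ultimately show "CSD D M s \<gamma> P Q"
      unfolding CSD by (intro bexI[of _ \<kappa>]) simp_all
  qed
qed

end
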